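(* Let $W$ be the complex Lie algebra with basis $\{L_m, I_m \mid m\in\mathbb{Z}\}$ and bracket $[L_m,L_n]=(m-n)L_{m+n}$, $[L_m,I_n]=(m-n)I_{m+n}$, $[I_m,I_n]=0$ for all $m,n\in\mathbb{Z}$. Let $\widetilde W$ be the complex Lie algebra with basis $\{L_n,I_n,C_1,C_2\mid n\in\mathbb{Z}\}$ and relations $$[L_m,L_n]=(m-n)L_{m+n}+\delta_{m+n,0}\frac{m^3-m}{12}C_1,\quad [L_m,I_n]=(m-n)I_{m+n}+\delta_{m+n,0}\frac{m^3-m}{12}C_2,$$ $$[I_m,I_n]=0,\quad [C_1,\widetilde W]=[C_2,\widetilde W]=0$$ for all $m,n\in\mathbb{Z}$. Then $$H^1(\widetilde W,\widetilde W)\simeq H^1(W,W).$$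
   Context: For a Lie algebra $\mathfrak g$, $H^1(\mathfrak g,\mathfrak g)$ is the quotient vector space of all derivations of $\mathfrak g$ by the inner derivations (coefficients in the adjoint module). *)

theory Defs
  imports
    Complex_Main
    "HOL-Library.Poly_Mapping"
    "HOL-Library.Function_Algebras"
    "HOL-Library.Set_Algebras"
begin

section \<open>Lie algebras, derivations and the first cohomology space\<close>

locale lie_algebra = vector_space scale
  for scale :: "'k::field \<Rightarrow> 'g::ab_group_add \<Rightarrow> 'g" +
  fixes bracket :: "'g \<Rightarrow> 'g \<Rightarrow> 'g"
  assumes bracket_add_left: "bracket (x + y) z = bracket x z + bracket y z"
    and bracket_add_right: "bracket x (y + z) = bracket x y + bracket x z"
    and bracket_scale_left: "bracket (scale a x) y = scale a (bracket x y)"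
    and bracket_scale_right: "bracket x (scale a y) = scale a (bracket x y)"
    and bracket_self: "bracket x x = 0"
    and jacobi: "bracket x (bracket y z) + bracket y (bracket z x) + bracket z (bracket x y) = 0"

definition derivations ::
    "('k::field \<Rightarrow> 'g::ab_group_add \<Rightarrow> 'g) \<Rightarrow> ('g \<Rightarrow> 'g \<Rightarrow> 'g) \<Rightarrow> ('g \<Rightarrow> 'g) set"
  where "derivations scale bracket =
    {D. Vector_Spaces.linear scale scale D \<and>
        (\<forall>x y. D (bracket x y) = bracket (D x) y + bracket x (D y))}"

definition inner_derivations :: "('g \<Rightarrow> 'g \<Rightarrow> 'g) \<Rightarrow> ('g \<Rightarrow> 'g) set"
  where "inner_derivations bracket = range (\<lambda>x. \<lambda>y. bracket x y)"

text \<open>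
  The elements of the quotient space are the cosets of the inner derivations inside the space of
  all derivations. Sums of cosets are sums of sets; in a scalar multiple, the inner derivations are
  added back so that \<open>0\<close> times a coset is the zero coset and not just \<open>{0}\<close>.
\<close>

definition H1 ::
    "('k::field \<Rightarrow> 'g::ab_group_add \<Rightarrow> 'g) \<Rightarrow> ('g \<Rightarrow> 'g \<Rightarrow> 'g) \<Rightarrow> ('g \<Rightarrow> 'g) set set"
  where "H1 scale bracket =
    (\<lambda>D. D +o inner_derivations bracket) ` derivations scale bracket"

definition H1_scale ::
    "('k::field \<Rightarrow> 'g::ab_group_add \<Rightarrow> 'g) \<Rightarrow> ('g \<Rightarrow> 'g \<Rightarrow> 'g) \<Rightarrow> 'k \<Rightarrow>
      ('g \<Rightarrow> 'g) set \<Rightarrow> ('g \<Rightarrow> 'g) set"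
  where "H1_scale scale bracket c A =
    (\<lambda>D. \<lambda>x. scale c (D x)) ` A + inner_derivations bracket"

definition H1_isomorphic ::
    "('k::field \<Rightarrow> 'g::ab_group_add \<Rightarrow> 'g) \<Rightarrow> ('g \<Rightarrow> 'g \<Rightarrow> 'g) \<Rightarrow>
     ('k \<Rightarrow> 'h::ab_group_add \<Rightarrow> 'h) \<Rightarrow> ('h \<Rightarrow> 'h \<Rightarrow> 'h) \<Rightarrow> bool"
  where "H1_isomorphic scale1 bracket1 scale2 bracket2 \<longleftrightarrow>
    (\<exists>\<phi>. bij_betw \<phi> (H1 scale1 bracket1) (H1 scale2 bracket2) \<and>
      (\<forall>A\<in>H1 scale1 bracket1. \<forall>B\<in>H1 scale1 bracket1. \<phi> (A + B) = \<phi> A + \<phi> B) \<and>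
      (\<forall>c. \<forall>A\<in>H1 scale1 bracket1.
        \<phi> (H1_scale scale1 bracket1 c A) = H1_scale scale2 bracket2 c (\<phi> A)))"

context lie_algebra
begin

lemma bracket_anti: "bracket y x = - bracket x y"
proof -
  have "bracket y x + bracket x y = 0"
    using bracket_self[of "x + y"] bracket_self[of x] bracket_self[of y]
    by (simp only: bracket_add_left bracket_add_right) (simp add: add.commute)
  then show ?thesis by (rule eq_neg_iff_add_eq_0[THEN iffD2])
qed

lemma bracket_zero_left [simp]: "bracket 0 x = 0"
  using bracket_add_left[of 0 0 x] by simp

lemma bracket_zero_right [simp]: "bracket x 0 = 0"
  using bracket_add_right[of x 0 0] by simp

lemma bracket_minus_left: "bracket (- x) y = - bracket x y"
  using bracket_add_left[of x "- x" y] by (simp add: eq_neg_iff_add_eq_0 add.commute)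

lemma bracket_minus_right: "bracket x (- y) = - bracket x y"
  using bracket_add_right[of x y "- y"] by (simp add: eq_neg_iff_add_eq_0 add.commute)

lemma linear_iff':
  "Vector_Spaces.linear scale scale D \<longleftrightarrow>
    (\<forall>x y. D (x + y) = D x + D y) \<and> (\<forall>c x. D (scale c x) = scale c (D x))"
  by (auto simp: Vector_Spaces.linear_iff vector_space_axioms)

lemma inner_derivations_subset: "inner_derivations bracket \<subseteq> derivations scale bracket"
proof
  fix D assume "D \<in> inner_derivations bracket"
  then obtain u where D: "D = bracket u" by (auto simp: inner_derivations_def)
  have "bracket u (bracket x y) = bracket (bracket u x) y + bracket x (bracket u y)" for x y
  proof -
    have "bracket x (bracket y u) = - bracket x (bracket u y)"
      using bracket_anti[of y u] by (simp add: bracket_minus_right)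
    moreover have "bracket y (bracket u x) = - bracket (bracket u x) y"
      by (rule bracket_anti)
    ultimately show ?thesis
      using jacobi[of u x y] by (simp add: algebra_simps)
  qed
  then show "D \<in> derivations scale bracket"
    by (simp add: derivations_def D linear_iff' bracket_add_right bracket_scale_right)
qed

lemma derivations_add:
  "D \<in> derivations scale bracket \<Longrightarrow> E \<in> derivations scale bracket \<Longrightarrow>
    D + E \<in> derivations scale bracket"
  by (simp add: derivations_def linear_iff' bracket_add_left bracket_add_right
      scale_right_distrib algebra_simps)

lemma derivations_scale:
  "D \<in> derivations scale bracket \<Longrightarrow> (\<lambda>x. scale c (D x)) \<in> derivations scale bracket"
  by (simp add: derivations_def linear_iff' bracket_scale_left bracket_scale_right
      scale_right_distrib mult.commute)

lemma inner_derivations_add: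
  "D \<in> inner_derivations bracket \<Longrightarrow> E \<in> inner_derivations bracket \<Longrightarrow>
    D + E \<in> inner_derivations bracket"
  by (fastforce simp: inner_derivations_def fun_eq_iff image_iff bracket_add_left[symmetric])

lemma inner_derivations_scale:
  "D \<in> inner_derivations bracket \<Longrightarrow> (\<lambda>x. scale c (D x)) \<in> inner_derivations bracket"
  by (fastforce simp: inner_derivations_def fun_eq_iff image_iff bracket_scale_left[symmetric])

lemma zero_inner: "0 \<in> inner_derivations bracket"
  by (auto simp: inner_derivations_def fun_eq_iff image_iff intro: exI[of _ 0])

lemma inner_plus_inner:
  "inner_derivations bracket + inner_derivations bracket = inner_derivations bracket"
proof (intro equalityI subsetI)
  fix D assume "D \<in> inner_derivations bracket"
  then have "0 + D \<in> inner_derivations bracket + inner_derivations bracket"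
    by (intro set_plus_intro zero_inner)
  then show "D \<in> inner_derivations bracket + inner_derivations bracket" by simp
qed (auto elim!: set_plus_elim intro: inner_derivations_add)

lemma H1_add_coset:
  "(D +o inner_derivations bracket) + (E +o inner_derivations bracket) =
    (D + E) +o inner_derivations bracket"
  by (simp add: set_plus_rearrange inner_plus_inner)

lemma H1_scale_coset:
  "H1_scale scale bracket c (D +o inner_derivations bracket) =
    (\<lambda>x. scale c (D x)) +o inner_derivations bracket"
proof -
  let ?I = "inner_derivations bracket"
  have s: "(\<lambda>x. scale c ((D + E) x)) = (\<lambda>x. scale c (D x)) + (\<lambda>x. scale c (E x))" for E
    by (simp add: fun_eq_iff scale_right_distrib)
  show ?thesis
  proof (intro equalityI subsetI)
    fix F assume "F \<in> H1_scale scale bracket c (D +o ?I)"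
    then obtain E G where "E \<in> ?I" "G \<in> ?I" "F = (\<lambda>x. scale c ((D + E) x)) + G"
      by (auto simp: H1_scale_def set_plus_def elt_set_plus_def)
    then show "F \<in> (\<lambda>x. scale c (D x)) +o ?I"
      using inner_derivations_add[OF inner_derivations_scale[of E c]]
      by (auto simp only: s elt_set_plus_def add.assoc)
  next
    fix F assume "F \<in> (\<lambda>x. scale c (D x)) +o ?I"
    then obtain G where G: "G \<in> ?I" "F = (\<lambda>x. scale c (D x)) + G"
      by (auto simp: elt_set_plus_def)
    have "D \<in> D +o ?I" using zero_inner by (force simp: elt_set_plus_def)
    then show "F \<in> H1_scale scale bracket c (D +o ?I)"
      using G by (auto simp: H1_scale_def set_plus_def)
  qed
qed

end

section \<open>Lie algebras given by a bracket on a basis\<close>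

definition pm_scale :: "'k::field \<Rightarrow> ('b \<Rightarrow>\<^sub>0 'k) \<Rightarrow> ('b \<Rightarrow>\<^sub>0 'k)"
  where "pm_scale c x = Poly_Mapping.map ((*) c) x"

definition bilinear_extension ::
    "('b \<Rightarrow> 'b \<Rightarrow> ('b \<Rightarrow>\<^sub>0 'k::field)) \<Rightarrow> ('b \<Rightarrow>\<^sub>0 'k) \<Rightarrow> ('b \<Rightarrow>\<^sub>0 'k) \<Rightarrow> ('b \<Rightarrow>\<^sub>0 'k)"
  where "bilinear_extension f x y =
    (\<Sum>i\<in>Poly_Mapping.keys x. \<Sum>j\<in>Poly_Mapping.keys y.
      pm_scale (Poly_Mapping.lookup x i * Poly_Mapping.lookup y j) (f i j))"

abbreviation basis_vector :: "'b \<Rightarrow> ('b \<Rightarrow>\<^sub>0 'k::field)"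
  where "basis_vector b \<equiv> Poly_Mapping.single b 1"

lemma lookup_pm_scale [simp]:
  "Poly_Mapping.lookup (pm_scale c x) b = c * Poly_Mapping.lookup x b"
  by (simp add: pm_scale_def Poly_Mapping.map.rep_eq when_def)

lemma vector_space_pm_scale: "vector_space (pm_scale :: 'k::field \<Rightarrow> _)"
  by unfold_locales (auto intro!: poly_mapping_eqI simp: lookup_add algebra_simps)

interpretation pm: vector_space "pm_scale :: 'k::field \<Rightarrow> ('b \<Rightarrow>\<^sub>0 'k) \<Rightarrow> ('b \<Rightarrow>\<^sub>0 'k)"
  by (rule vector_space_pm_scale)

lemma pm_scale_single [simp]:
  "pm_scale c (Poly_Mapping.single b a) = Poly_Mapping.single b (c * a)"
  by (rule poly_mapping_eqI) (simp add: lookup_single when_def)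

lemma poly_mapping_eq_sum:
  assumes "finite A" "Poly_Mapping.keys x \<subseteq> A"
  shows "x = (\<Sum>i\<in>A. pm_scale (Poly_Mapping.lookup x i) (basis_vector i))"
  using assms
  by (intro poly_mapping_eqI)
    (auto simp: lookup_sum lookup_single when_def in_keys_iff)

lemma span_basis_vectors: "pm.span (range (basis_vector :: 'b \<Rightarrow> ('b \<Rightarrow>\<^sub>0 'k::field))) = UNIV"
proof -
  have "x \<in> pm.span (range basis_vector)" for x :: "'b \<Rightarrow>\<^sub>0 'k"
    by (subst poly_mapping_eq_sum[OF finite_keys order.refl])
      (intro pm.span_sum pm.span_scale pm.span_base rangeI)
  then show ?thesis by auto
qed

lemma inj_basis_vector: "inj (basis_vector :: 'b \<Rightarrow> ('b \<Rightarrow>\<^sub>0 'k::field))"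
proof (rule injI)
  fix a b assume "basis_vector a = (basis_vector b :: 'b \<Rightarrow>\<^sub>0 'k)"
  then have "Poly_Mapping.lookup (basis_vector a) a =
      Poly_Mapping.lookup (basis_vector b :: 'b \<Rightarrow>\<^sub>0 'k) a" by simp
  then show "a = b" by (simp add: lookup_single when_def split: if_splits)
qed

lemma independent_basis_vectors:
  "pm.independent (range (basis_vector :: 'b \<Rightarrow> ('b \<Rightarrow>\<^sub>0 'k::field)))"
proof -
  have "u v = 0"
    if t: "finite t" "t \<subseteq> range basis_vector" "(\<Sum>v\<in>t. pm_scale (u v) v) = 0" "v \<in> t"
    for t v and u :: "('b \<Rightarrow>\<^sub>0 'k) \<Rightarrow> 'k"
  proof -
    obtain b where v: "v = basis_vector b" using t by auto
    have "Poly_Mapping.lookup w b = (if w = v then 1 else 0)" if "w \<in> t" for w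
      using t(2) that v by (auto simp: lookup_single when_def dest: injD[OF inj_basis_vector])
    then have "(\<Sum>w\<in>t. u w * Poly_Mapping.lookup w b) = (\<Sum>w\<in>t. if w = v then u w else 0)"
      by (intro sum.cong) auto
    moreover have "(\<Sum>w\<in>t. u w * Poly_Mapping.lookup w b) = 0"
      using arg_cong[OF t(3), of "\<lambda>x. Poly_Mapping.lookup x b"] by (simp add: lookup_sum)
    ultimately show ?thesis using t by simp
  qed
  then show ?thesis unfolding pm.dependent_explicit by blast
qed

lemma bilinear_extension_superset:
  assumes "finite A" "Poly_Mapping.keys x \<subseteq> A" "finite B" "Poly_Mapping.keys y \<subseteq> B"
  shows "bilinear_extension f x y =
    (\<Sum>i\<in>A. \<Sum>j\<in>B. pm_scale (Poly_Mapping.lookup x i * Poly_Mapping.lookup y j) (f i j))"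
proof -
  have "(\<Sum>j\<in>Poly_Mapping.keys y. pm_scale (Poly_Mapping.lookup x i * Poly_Mapping.lookup y j) (f i j))
     = (\<Sum>j\<in>B. pm_scale (Poly_Mapping.lookup x i * Poly_Mapping.lookup y j) (f i j))" for i
    using assms by (intro sum.mono_neutral_left) (auto simp: in_keys_iff)
  then show ?thesis
    unfolding bilinear_extension_def
    using assms by (simp, intro sum.mono_neutral_left) (auto simp: in_keys_iff)
qed

lemma bilinear_extension_basis [simp]:
  "bilinear_extension f (basis_vector i) (basis_vector j) = f i j"
  by (simp add: bilinear_extension_def)

lemma bilinear_extension_add_left:
  "bilinear_extension f (x + y) z = bilinear_extension f x z + bilinear_extension f y z"
proof -
  define A where "A = Poly_Mapping.keys x \<union> Poly_Mapping.keys y"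
  have A: "finite A" "Poly_Mapping.keys x \<subseteq> A" "Poly_Mapping.keys y \<subseteq> A"
      "Poly_Mapping.keys (x + y) \<subseteq> A"
    using keys_add[of x y] by (auto simp: A_def)
  note s = bilinear_extension_superset[OF A(1) _ finite_keys order.refl]
  show ?thesis
    by (simp add: s[OF A(2)] s[OF A(3)] s[OF A(4)] lookup_add distrib_right
        pm.scale_left_distrib sum.distrib)
qed

lemma bilinear_extension_add_right:
  "bilinear_extension f z (x + y) = bilinear_extension f z x + bilinear_extension f z y"
proof -
  define A where "A = Poly_Mapping.keys x \<union> Poly_Mapping.keys y"
  have A: "finite A" "Poly_Mapping.keys x \<subseteq> A" "Poly_Mapping.keys y \<subseteq> A"
      "Poly_Mapping.keys (x + y) \<subseteq> A"
    using keys_add[of x y] by (auto simp: A_def)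
  note s = bilinear_extension_superset[OF finite_keys order.refl A(1)]
  show ?thesis
    by (simp add: s[OF A(2)] s[OF A(3)] s[OF A(4)] lookup_add distrib_left
        pm.scale_left_distrib sum.distrib)
qed

lemma keys_pm_scale_subset: "Poly_Mapping.keys (pm_scale c x) \<subseteq> Poly_Mapping.keys x"
  by (auto simp: in_keys_iff)

lemma bilinear_extension_scale_left:
  "bilinear_extension f (pm_scale c x) y = pm_scale c (bilinear_extension f x y)"
  by (subst bilinear_extension_superset[OF finite_keys keys_pm_scale_subset finite_keys order.refl])
    (simp add: bilinear_extension_def pm.scale_sum_right mult.assoc)

lemma bilinear_extension_scale_right:
  "bilinear_extension f y (pm_scale c x) = pm_scale c (bilinear_extension f y x)"
  by (subst bilinear_extension_superset[OF finite_keys order.refl finite_keys keys_pm_scale_subset])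
    (simp add: bilinear_extension_def pm.scale_sum_right ac_simps)

lemma additive_eq_zero:
  assumes "\<And>x y. g (x + y) = g x + (g y :: 'b \<Rightarrow>\<^sub>0 'k::field)"
    and "\<And>c x. g (pm_scale c x) = pm_scale c (g x)"
    and "\<And>b. g (basis_vector b) = 0"
  shows "g x = 0"
proof -
  have "x \<in> pm.span (range basis_vector)" by (simp add: span_basis_vectors)
  then show ?thesis
    by (induction rule: pm.span_induct_alt) (use assms(1)[of 0 0] assms in auto)
qed

lemma lie_algebra_bilinear_extension:
  fixes f :: "'b \<Rightarrow> 'b \<Rightarrow> ('b \<Rightarrow>\<^sub>0 'k::field_char_0)"
  assumes anti: "\<And>i j. f j i = - f i j"
    and jac: "\<And>i j k.
      bilinear_extension f (basis_vector i) (f j k) + bilinear_extension f (basis_vector j) (f k i) +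
      bilinear_extension f (basis_vector k) (f i j) = 0"
  shows "lie_algebra pm_scale (bilinear_extension f)"
proof -
  let ?b = "bilinear_extension f"
  note lin = bilinear_extension_add_left bilinear_extension_add_right
    bilinear_extension_scale_left bilinear_extension_scale_right pm.scale_right_distrib
  have anti': "?b x y + ?b y x = 0" for x y
  proof (rule additive_eq_zero[where g = "\<lambda>x. ?b x y + ?b y x"])
    fix i
    show "?b (basis_vector i) y + ?b y (basis_vector i) = 0"
      by (rule additive_eq_zero[where g = "\<lambda>y. ?b (basis_vector i) y + ?b y (basis_vector i)"])
        (auto simp: lin anti[of _ i])
  qed (auto simp: lin)
  have self: "?b x x = 0" for x
  proof -
    have "pm_scale 2 (?b x x) = ?b x x + ?b x x"
      using pm.scale_left_distrib[of 1 1 "?b x x"] by simp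
    then show ?thesis using anti'[of x x] by simp
  qed
  have jac': "?b x (?b y z) + ?b y (?b z x) + ?b z (?b x y) = 0" for x y z
  proof (rule additive_eq_zero[where g = "\<lambda>x. ?b x (?b y z) + ?b y (?b z x) + ?b z (?b x y)"])
    fix i let ?i = "basis_vector i :: 'b \<Rightarrow>\<^sub>0 'k"
    show "?b ?i (?b y z) + ?b y (?b z ?i) + ?b z (?b ?i y) = 0"
    proof (rule additive_eq_zero[where g = "\<lambda>y. ?b ?i (?b y z) + ?b y (?b z ?i) + ?b z (?b ?i y)"])
      fix j let ?j = "basis_vector j :: 'b \<Rightarrow>\<^sub>0 'k"
      show "?b ?i (?b ?j z) + ?b ?j (?b z ?i) + ?b z (?b ?i ?j) = 0"
        by (rule additive_eq_zero
              [where g = "\<lambda>z. ?b ?i (?b ?j z) + ?b ?j (?b z ?i) + ?b z (?b ?i ?j)"])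
          (simp_all add: lin jac del: pm_scale_single)
    qed (simp_all add: lin)
  qed (simp_all add: lin)
  show ?thesis
    by unfold_locales (auto simp: lin self jac')
qed

section \<open>The algebra \<open>W\<close> and its central extension\<close>

text \<open>
  The brackets of \<open>I_m\<close> with \<open>L_n\<close> are not listed among the defining relations; they are given by
  antisymmetry. The algebras have no topology: elements are finite linear combinations of the basis.
\<close>

datatype W_index = L int | I int

fun W_bracket_basis :: "W_index \<Rightarrow> W_index \<Rightarrow> (W_index \<Rightarrow>\<^sub>0 complex)"
  where
    "W_bracket_basis (L m) (L n) = pm_scale (of_int (m - n)) (basis_vector (L (m + n)))"
  | "W_bracket_basis (L m) (I n) = pm_scale (of_int (m - n)) (basis_vector (I (m + n)))"
  | "W_bracket_basis (I m) (L n) = - pm_scale (of_int (n - m)) (basis_vector (I (n + m)))"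
  | "W_bracket_basis (I m) (I n) = 0"

definition W_bracket ::
    "(W_index \<Rightarrow>\<^sub>0 complex) \<Rightarrow> (W_index \<Rightarrow>\<^sub>0 complex) \<Rightarrow> (W_index \<Rightarrow>\<^sub>0 complex)"
  where "W_bracket = bilinear_extension W_bracket_basis"

datatype Wt_index = Lt int | It int | C1 | C2

definition cocycle :: "int \<Rightarrow> int \<Rightarrow> complex"
  where "cocycle m n = (if m + n = 0 then of_int (m ^ 3 - m) / 12 else 0)"

fun Wt_bracket_basis :: "Wt_index \<Rightarrow> Wt_index \<Rightarrow> (Wt_index \<Rightarrow>\<^sub>0 complex)"
  where
    "Wt_bracket_basis (Lt m) (Lt n) =
      pm_scale (of_int (m - n)) (basis_vector (Lt (m + n))) +
      pm_scale (cocycle m n) (basis_vector C1)"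
  | "Wt_bracket_basis (Lt m) (It n) =
      pm_scale (of_int (m - n)) (basis_vector (It (m + n))) +
      pm_scale (cocycle m n) (basis_vector C2)"
  | "Wt_bracket_basis (It m) (Lt n) =
      - (pm_scale (of_int (n - m)) (basis_vector (It (n + m))) +
         pm_scale (cocycle n m) (basis_vector C2))"
  | "Wt_bracket_basis (It m) (It n) = 0"
  | "Wt_bracket_basis C1 _ = 0"
  | "Wt_bracket_basis C2 _ = 0"
  | "Wt_bracket_basis _ C1 = 0"
  | "Wt_bracket_basis _ C2 = 0"

definition Wt_bracket ::
    "(Wt_index \<Rightarrow>\<^sub>0 complex) \<Rightarrow> (Wt_index \<Rightarrow>\<^sub>0 complex) \<Rightarrow> (Wt_index \<Rightarrow>\<^sub>0 complex)"
  where "Wt_bracket = bilinear_extension Wt_bracket_basis"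

lemma bilinear_extension_single [simp]:
  "bilinear_extension f (Poly_Mapping.single i a) (Poly_Mapping.single j b) =
    pm_scale (a * b) (f i j)"
proof -
  have "bilinear_extension f (pm_scale a (basis_vector i)) (pm_scale b (basis_vector j)) =
      pm_scale (a * b) (f i j)"
    by (simp add: bilinear_extension_scale_left bilinear_extension_scale_right
        del: pm_scale_single)
  then show ?thesis by simp
qed

lemma bilinear_extension_minus_right [simp]:
  "bilinear_extension f x (- y) = - bilinear_extension f x y"
  using bilinear_extension_add_right[of f x y "- y"] bilinear_extension_add_right[of f x 0 0]
  by (simp add: eq_neg_iff_add_eq_0 add.commute)

lemma bilinear_extension_diff_right:
  "bilinear_extension f x (y - z) = bilinear_extension f x y - bilinear_extension f x z"
  using bilinear_extension_add_right[of f x y "- z"] by simp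

lemma bilinear_extension_zero_right [simp]: "bilinear_extension f x 0 = 0"
  using bilinear_extension_add_right[of f x 0 0] by simp

lemma W_lie_algebra: "lie_algebra pm_scale W_bracket"
  unfolding W_bracket_def
proof (rule lie_algebra_bilinear_extension)
  show "W_bracket_basis j i = - W_bracket_basis i j" for i j
    by (cases i; cases j)
      (auto intro!: poly_mapping_eqI simp: lookup_single lookup_add when_def add.commute)
  show "bilinear_extension W_bracket_basis (basis_vector i) (W_bracket_basis j k) +
      bilinear_extension W_bracket_basis (basis_vector j) (W_bracket_basis k i) +
      bilinear_extension W_bracket_basis (basis_vector k) (W_bracket_basis i j) = 0" for i j k
    by (cases i; cases j; cases k)
      (auto intro!: poly_mapping_eqI
        simp: lookup_single lookup_add when_def algebra_simps)
qed

lemma Wt_lie_algebra: "lie_algebra pm_scale Wt_bracket"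
  unfolding Wt_bracket_def
proof (rule lie_algebra_bilinear_extension)
  have c: "cocycle n m = - cocycle m n" for m n
  proof (cases "m + n = 0")
    case True
    then have "n = - m" by simp
    then show ?thesis by (simp add: cocycle_def add_divide_distrib diff_divide_distrib)
  qed (auto simp: cocycle_def add.commute)
  have j: "of_int (n - k) * cocycle m (n + k) + of_int (k - m) * cocycle n (k + m) +
      of_int (m - n) * cocycle k (m + n) = 0" for m n k
  proof (cases "m + n + k = 0")
    case True
    then have "k = - m - n" by simp
    then show ?thesis
      by (simp add: cocycle_def) (simp add: field_simps power3_eq_cube)
  qed (auto simp: cocycle_def algebra_simps)
  have LL: "Wt_bracket_basis (Lt n) (Lt m) = - Wt_bracket_basis (Lt m) (Lt n)" for m n
    by (auto intro!: poly_mapping_eqI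
        simp: lookup_single lookup_add lookup_minus when_def add.commute c[of m n])
  show "Wt_bracket_basis j i = - Wt_bracket_basis i j" for i j
  proof (cases i; cases j)
    fix m n
    show "i = Lt m \<Longrightarrow> j = Lt n \<Longrightarrow> Wt_bracket_basis j i = - Wt_bracket_basis i j"
      by (simp only: LL[of m n] minus_minus)
  qed auto
  define J where "J i j k =
      bilinear_extension Wt_bracket_basis (basis_vector i) (Wt_bracket_basis j k) +
      bilinear_extension Wt_bracket_basis (basis_vector j) (Wt_bracket_basis k i) +
      bilinear_extension Wt_bracket_basis (basis_vector k) (Wt_bracket_basis i j)" for i j k
  have rot: "J i j k = J k i j" for i j k
    by (simp add: J_def ac_simps)
  have "J (Lt m) (Lt n) (Lt k) = pm_scale (of_int (n - k) * cocycle m (n + k) +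
      of_int (k - m) * cocycle n (k + m) + of_int (m - n) * cocycle k (m + n)) (basis_vector C1)"
      for m n k
    by (rule poly_mapping_eqI)
      (auto simp: J_def bilinear_extension_add_right lookup_add lookup_single when_def algebra_simps)
  then have LLL: "J (Lt m) (Lt n) (Lt k) = 0" for m n k
    by (simp only: j) simp
  have "J (Lt m) (Lt n) (It k) = pm_scale (of_int (n - k) * cocycle m (n + k) +
      of_int (k - m) * cocycle n (k + m) + of_int (m - n) * (- cocycle (m + n) k)) (basis_vector C2)"
      for m n k
    by (rule poly_mapping_eqI)
      (auto simp: J_def bilinear_extension_add_right bilinear_extension_diff_right lookup_add
        lookup_minus lookup_single when_def algebra_simps)
  then have LLI: "J (Lt m) (Lt n) (It k) = 0" for m n k
    by (simp only: c[symmetric] j) simp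
  have "J i j k = 0" for i j k
  proof (cases i; cases j; cases k)
    fix m n l
    show "i = Lt m \<Longrightarrow> j = It n \<Longrightarrow> k = Lt l \<Longrightarrow> J i j k = 0"
      using LLI[of l m n] rot[of "Lt m" "It n" "Lt l"] by simp
    show "i = It m \<Longrightarrow> j = Lt n \<Longrightarrow> k = Lt l \<Longrightarrow> J i j k = 0"
      using LLI[of n l m] rot[of "It m" "Lt n" "Lt l"] rot[of "Lt l" "It m" "Lt n"] by simp
  qed (auto simp: LLL LLI, (simp_all add: J_def bilinear_extension_add_right bilinear_extension_diff_right))
  then show "bilinear_extension Wt_bracket_basis (basis_vector i) (Wt_bracket_basis j k) +
      bilinear_extension Wt_bracket_basis (basis_vector j) (Wt_bracket_basis k i) +
      bilinear_extension Wt_bracket_basis (basis_vector k) (Wt_bracket_basis i j) = 0" for i j k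
    by (simp add: J_def)
qed

lemma W_relations:
  "W_bracket (basis_vector (L m)) (basis_vector (L n)) =
    pm_scale (of_int (m - n)) (basis_vector (L (m + n)))"
  "W_bracket (basis_vector (L m)) (basis_vector (I n)) =
    pm_scale (of_int (m - n)) (basis_vector (I (m + n)))"
  "W_bracket (basis_vector (I m)) (basis_vector (I n)) = 0"
  by (simp_all add: W_bracket_def)

lemma Wt_relations:
  "Wt_bracket (basis_vector (Lt m)) (basis_vector (Lt n)) =
    pm_scale (of_int (m - n)) (basis_vector (Lt (m + n))) +
    pm_scale (if m + n = 0 then (of_int m ^ 3 - of_int m) / 12 else 0) (basis_vector C1)"
  "Wt_bracket (basis_vector (Lt m)) (basis_vector (It n)) =
    pm_scale (of_int (m - n)) (basis_vector (It (m + n))) +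
    pm_scale (if m + n = 0 then (of_int m ^ 3 - of_int m) / 12 else 0) (basis_vector C2)"
  "Wt_bracket (basis_vector (It m)) (basis_vector (It n)) = 0"
  by (simp_all add: Wt_bracket_def cocycle_def)

lemma Wt_central: "Wt_bracket (basis_vector C1) x = 0" "Wt_bracket (basis_vector C2) x = 0"
  by (simp_all add: Wt_bracket_def bilinear_extension_def)

end

theory Submission
  imports Defs
begin

text \<open>
  The projection \<open>\<pi>\<close> from the extension onto \<open>W\<close> has central kernel and a linear section \<open>\<sigma>\<close>, and
  \<open>D \<mapsto> \<pi> \<circ> D \<circ> \<sigma>\<close> induces the isomorphism. It takes derivations to derivations because \<open>W\<close> has
  trivial center. If \<open>\<pi> \<circ> D \<circ> \<sigma>\<close> is inner, then \<open>D\<close> differs from an inner derivation by a derivation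
  with central values; this one kills all brackets, so it is zero because the extension is perfect.
  For surjectivity it suffices that every derivation of \<open>W\<close> is the sum of an inner one and a multiple
  of the projection onto the span of the \<open>I_n\<close>, since the latter lifts.
\<close>

section \<open>Isomorphisms of first cohomology spaces\<close>

lemma (in lie_algebra) coset_eq_iff:
  "D +o inner_derivations bracket = E +o inner_derivations bracket \<longleftrightarrow>
    D - E \<in> inner_derivations bracket"
proof
  assume "D +o inner_derivations bracket = E +o inner_derivations bracket"
  moreover have "D \<in> D +o inner_derivations bracket"
    using zero_inner by (force simp: elt_set_plus_def)
  ultimately show "D - E \<in> inner_derivations bracket"
    by (auto simp: elt_set_plus_def)
next
  assume 1: "D - E \<in> inner_derivations bracket"
  have 2: "E - D \<in> inner_derivations bracket"
    using inner_derivations_scale[OF 1, of "- 1"] by (simp add: fun_diff_def)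
  have "G \<in> E' +o inner_derivations bracket"
    if G: "G \<in> D' +o inner_derivations bracket" and DE: "D' - E' \<in> inner_derivations bracket"
    for D' E' G
  proof -
    obtain H where H: "H \<in> inner_derivations bracket" "G = D' + H"
      using G by (auto simp: elt_set_plus_def)
    have "G = E' + ((D' - E') + H)" by (simp add: H)
    then show ?thesis
      using inner_derivations_add[OF DE H(1)] unfolding elt_set_plus_def by blast
  qed
  then show "D +o inner_derivations bracket = E +o inner_derivations bracket"
    using 1 2 by blast
qed

lemma H1_isomorphicI:
  assumes g: "lie_algebra s1 b1" and h: "lie_algebra s2 b2"
    and add: "\<And>D E. D \<in> derivations s1 b1 \<Longrightarrow> E \<in> derivations s1 b1 \<Longrightarrow> F (D + E) = F D + F E"
    and scale: "\<And>c D. D \<in> derivations s1 b1 \<Longrightarrow> F (\<lambda>x. s1 c (D x)) = (\<lambda>x. s2 c (F D x))"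
    and inner: "F ` inner_derivations b1 = inner_derivations b2"
    and der: "F ` derivations s1 b1 = derivations s2 b2"
    and ker: "\<And>D. D \<in> derivations s1 b1 \<Longrightarrow> F D \<in> inner_derivations b2 \<Longrightarrow> D \<in> inner_derivations b1"
  shows "H1_isomorphic s1 b1 s2 b2"
proof -
  interpret g: lie_algebra s1 b1 by (rule g)
  interpret h: lie_algebra s2 b2 by (rule h)
  have elt_set_plus_image: "a +o A = (\<lambda>b. a + b) ` A" for a :: "'x::plus" and A
    by (auto simp: elt_set_plus_def)
  note inc = g.inner_derivations_subset[THEN subsetD]
  have coset: "F ` (D +o inner_derivations b1) = F D +o inner_derivations b2"
    if "D \<in> derivations s1 b1" for D
  proof -
    have "F ` (D +o inner_derivations b1) = (\<lambda>G. F D + F G) ` inner_derivations b1"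
      unfolding elt_set_plus_image image_image using that by (auto intro!: image_cong add inc)
    also have "\<dots> = F D +o inner_derivations b2"
      by (simp add: inner[symmetric] elt_set_plus_image image_image)
    finally show ?thesis .
  qed
  \<comment> \<open>Only sums and scalar multiples are known to be respected by \<open>F\<close>, so
    the difference is formed with the scalar \<open>- 1\<close>.\<close>
  have diff: "D - E \<in> derivations s1 b1 \<and> F (D - E) = F D - F E"
    if "D \<in> derivations s1 b1" "E \<in> derivations s1 b1" for D E
  proof -
    have E: "(\<lambda>x. s1 (- 1) (E x)) \<in> derivations s1 b1"
      using that(2) by (rule g.derivations_scale)
    have "D - E = D + (\<lambda>x. s1 (- 1) (E x))" by (simp add: fun_eq_iff)
    then show ?thesis
      using g.derivations_add[OF that(1) E] add[OF that(1) E] scale[OF that(2), of "- 1"]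
      by (simp only:) (simp add: fun_eq_iff)
  qed
  have "bij_betw ((`) F) (H1 s1 b1) (H1 s2 b2)"
  proof (rule bij_betw_imageI)
    show "inj_on ((`) F) (H1 s1 b1)"
    proof (rule inj_onI)
      fix A B assume A: "A \<in> H1 s1 b1" and B: "B \<in> H1 s1 b1" and eq: "F ` A = F ` B"
      obtain D where D: "D \<in> derivations s1 b1" "A = D +o inner_derivations b1"
        using A by (auto simp: H1_def)
      obtain E where E: "E \<in> derivations s1 b1" "B = E +o inner_derivations b1"
        using B by (auto simp: H1_def)
      have "F (D - E) \<in> inner_derivations b2"
        using eq by (simp add: D E coset h.coset_eq_iff diff)
      then have "D - E \<in> inner_derivations b1" using D E diff ker by blast
      then show "A = B" by (simp add: D E g.coset_eq_iff)
    qed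
    show "(`) F ` H1 s1 b1 = H1 s2 b2"
      by (simp add: H1_def image_image coset der[symmetric] cong: image_cong)
  qed
  moreover have "F ` (A + B) = F ` A + F ` B"
    if A: "A \<in> H1 s1 b1" and B: "B \<in> H1 s1 b1" for A B
  proof -
    obtain D where D: "D \<in> derivations s1 b1" "A = D +o inner_derivations b1"
      using A by (auto simp: H1_def)
    obtain E where E: "E \<in> derivations s1 b1" "B = E +o inner_derivations b1"
      using B by (auto simp: H1_def)
    show ?thesis
      using D(1) E(1) g.derivations_add
      by (simp add: D(2) E(2) g.H1_add_coset h.H1_add_coset coset add)
  qed
  moreover have "F ` H1_scale s1 b1 c A = H1_scale s2 b2 c (F ` A)" if A: "A \<in> H1 s1 b1" for c A
  proof -
    obtain D where D: "D \<in> derivations s1 b1" "A = D +o inner_derivations b1"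
      using A by (auto simp: H1_def)
    show ?thesis
      using D(1) g.derivations_scale
      by (simp add: D(2) g.H1_scale_coset h.H1_scale_coset coset scale)
  qed
  ultimately show ?thesis unfolding H1_isomorphic_def by blast
qed

section \<open>Linear maps on spaces with a distinguished basis\<close>

abbreviation pm_linear :: "(('a \<Rightarrow>\<^sub>0 'k::field) \<Rightarrow> ('b \<Rightarrow>\<^sub>0 'k)) \<Rightarrow> bool"
  where "pm_linear \<equiv> Vector_Spaces.linear pm_scale pm_scale"

lemma pm_linear_iff:
  "pm_linear f \<longleftrightarrow> (\<forall>x y. f (x + y) = f x + f y) \<and> (\<forall>c x. f (pm_scale c x) = pm_scale c (f x))"
  by (auto simp: Vector_Spaces.linear_iff vector_space_pm_scale)

lemma pm_linear_add: "pm_linear f \<Longrightarrow> f (x + y) = f x + f y"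
  and pm_linear_scale: "pm_linear f \<Longrightarrow> f (pm_scale c x) = pm_scale c (f x)"
  by (simp_all add: pm_linear_iff)

lemma pm_linear_zero: "pm_linear f \<Longrightarrow> f 0 = 0"
  using pm_linear_add[of f 0 0] by simp

lemma pm_linear_minus: "pm_linear f \<Longrightarrow> f (- x) = - f x"
  using pm_linear_add[of f x "- x"] by (simp add: pm_linear_zero eq_neg_iff_add_eq_0 add.commute)

lemma pm_linear_diff: "pm_linear f \<Longrightarrow> f (x - y) = f x - f y"
  using pm_linear_add[of f x "- y"] by (simp add: pm_linear_minus)

lemmas pm_linear_simps =
  pm_linear_add pm_linear_scale pm_linear_zero pm_linear_minus pm_linear_diff

lemma basis_induct [case_names zero add]:
  assumes "P 0" and "\<And>c b x. P x \<Longrightarrow> P (pm_scale c (basis_vector b) + x)"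
  shows "P (x :: 'b \<Rightarrow>\<^sub>0 'k::field)"
proof -
  have "x \<in> pm.span (range basis_vector)" by (simp add: span_basis_vectors)
  then show ?thesis
    by (induction rule: pm.span_induct_alt) (use assms in auto)
qed

lemma pm_linear_eqI:
  assumes "pm_linear f" "pm_linear g" "\<And>b. f (basis_vector b) = g (basis_vector b)"
  shows "f x = g x"
  by (induction x rule: basis_induct) (simp_all add: assms pm_linear_simps del: pm_scale_single)

definition linear_extension :: "('a \<Rightarrow> ('b \<Rightarrow>\<^sub>0 'k)) \<Rightarrow> ('a \<Rightarrow>\<^sub>0 'k) \<Rightarrow> ('b \<Rightarrow>\<^sub>0 'k::field)"
  where "linear_extension f x =
    (\<Sum>i\<in>Poly_Mapping.keys x. pm_scale (Poly_Mapping.lookup x i) (f i))"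

text \<open>Indices outside the support contribute zero. One index set can therefore serve
  \<open>x\<close>, \<open>y\<close> and \<open>x + y\<close> at once, which makes additivity a
  termwise identity.\<close>

lemma linear_extension_superset:
  assumes "finite A" "Poly_Mapping.keys x \<subseteq> A"
  shows "linear_extension f x = (\<Sum>i\<in>A. pm_scale (Poly_Mapping.lookup x i) (f i))"
  unfolding linear_extension_def
  using assms by (intro sum.mono_neutral_left) (auto simp: in_keys_iff)

lemma linear_extension_basis [simp]: "linear_extension f (basis_vector i) = f i"
  by (simp add: linear_extension_def)

lemma pm_linear_extension:
  fixes f :: "'a \<Rightarrow> ('b \<Rightarrow>\<^sub>0 'k::field)"
  shows "pm_linear (linear_extension f)"
  unfolding pm_linear_iff
proof (intro conjI allI)
  fix x y :: "'a \<Rightarrow>\<^sub>0 'k"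
  define A where "A = Poly_Mapping.keys x \<union> Poly_Mapping.keys y"
  have A: "finite A" "Poly_Mapping.keys x \<subseteq> A" "Poly_Mapping.keys y \<subseteq> A"
      "Poly_Mapping.keys (x + y) \<subseteq> A"
    using keys_add[of x y] by (auto simp: A_def)
  note s = linear_extension_superset[OF A(1)]
  show "linear_extension f (x + y) = linear_extension f x + linear_extension f y"
    by (simp add: s[OF A(2)] s[OF A(3)] s[OF A(4)] lookup_add pm.scale_left_distrib sum.distrib)
next
  fix c x
  show "linear_extension f (pm_scale c x) = pm_scale c (linear_extension f x)"
    by (subst linear_extension_superset[OF finite_keys keys_pm_scale_subset])
      (simp add: linear_extension_def pm.scale_sum_right)
qed

lemma bilinear_map_eqI:
  assumes f: "\<And>y. pm_linear (\<lambda>x. f x y)" "\<And>x. pm_linear (f x)"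
    and g: "\<And>y. pm_linear (\<lambda>x. g x y)" "\<And>x. pm_linear (g x)"
    and eq: "\<And>i j. f (basis_vector i) (basis_vector j) = g (basis_vector i) (basis_vector j)"
  shows "f x y = g x y"
  by (rule pm_linear_eqI[OF f(1) g(1) pm_linear_eqI[OF f(2) g(2) eq]])

lemma bilinear_extension_linear:
  "pm_linear (bilinear_extension f x)" "pm_linear (\<lambda>x. bilinear_extension f x y)"
  by (simp_all add: pm_linear_iff bilinear_extension_add_left bilinear_extension_add_right
      bilinear_extension_scale_left bilinear_extension_scale_right)

text \<open>Both sides of the Leibniz rule are bilinear in the two arguments, so pairs of basis
  vectors decide.\<close>

lemma derivation_on_basisI:
  assumes D: "pm_linear D"
    and basis: "\<And>i j. D (f i j) = bilinear_extension f (D (basis_vector i)) (basis_vector j) +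
      bilinear_extension f (basis_vector i) (D (basis_vector j))"
  shows "D \<in> derivations pm_scale (bilinear_extension f)"
proof -
  have "D (bilinear_extension f x y) =
      bilinear_extension f (D x) y + bilinear_extension f x (D y)" for x y
    by (rule bilinear_map_eqI[where f = "\<lambda>x y. D (bilinear_extension f x y)"])
      (simp_all add: pm_linear_iff pm_linear_simps[OF D] bilinear_extension_add_left
        bilinear_extension_add_right bilinear_extension_scale_left bilinear_extension_scale_right
        basis algebra_simps)
  with D show ?thesis by (simp add: derivations_def)
qed

section \<open>Derivations of \<open>W\<close>\<close>

interpretation W: lie_algebra pm_scale W_bracket by (rule W_lie_algebra)
interpretation Wt: lie_algebra pm_scale Wt_bracket by (rule Wt_lie_algebra)

section \<open>Coordinates of brackets in \<open>W\<close>, its trivial center and the outer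
  derivation\<close>

lemma W_bracket_basis_vectors:
  "W_bracket (basis_vector i) (basis_vector j) = W_bracket_basis i j"
  by (simp add: W_bracket_def)

text \<open>Only the component of \<open>y\<close> in degree \<open>k - m\<close> reaches degree
  \<open>k\<close>, and the structure constant is \<open>m - (k - m)\<close>.\<close>

lemma lookup_W_bracket_L:
  "Poly_Mapping.lookup (W_bracket (basis_vector (L m)) y) (L k) =
    of_int (2 * m - k) * Poly_Mapping.lookup y (L (k - m))"
  "Poly_Mapping.lookup (W_bracket (basis_vector (L m)) y) (I k) =
    of_int (2 * m - k) * Poly_Mapping.lookup y (I (k - m))"
proof (induction y rule: basis_induct)
  case (add c b x)
  { case 1
    show ?case using add
      by (cases b) (auto simp: W.bracket_add_right W.bracket_scale_right W_bracket_basis_vectors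
          lookup_add lookup_minus lookup_single when_def algebra_simps simp del: pm_scale_single) }
  { case 2
    show ?case using add
      by (cases b) (auto simp: W.bracket_add_right W.bracket_scale_right W_bracket_basis_vectors
          lookup_add lookup_minus lookup_single when_def algebra_simps simp del: pm_scale_single) }
qed simp_all

lemma lookup_W_bracket_I:
  "Poly_Mapping.lookup (W_bracket (basis_vector (I m)) y) (L k) = 0"
  "Poly_Mapping.lookup (W_bracket (basis_vector (I m)) y) (I k) =
    of_int (2 * m - k) * Poly_Mapping.lookup y (L (k - m))"
proof (induction y rule: basis_induct)
  case (add c b x)
  { case 1
    show ?case using add
      by (cases b) (auto simp: W.bracket_add_right W.bracket_scale_right W_bracket_basis_vectors
          lookup_add lookup_minus lookup_single when_def algebra_simps simp del: pm_scale_single) }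
  { case 2
    show ?case using add
      by (cases b) (auto simp: W.bracket_add_right W.bracket_scale_right W_bracket_basis_vectors
          lookup_add lookup_minus lookup_single when_def algebra_simps simp del: pm_scale_single) }
qed simp_all

lemma W_eqI:
  assumes "\<And>k. Poly_Mapping.lookup x (L k) = Poly_Mapping.lookup y (L k)"
    and "\<And>k. Poly_Mapping.lookup x (I k) = Poly_Mapping.lookup y (I k)"
  shows "x = y"
proof (rule poly_mapping_eqI)
  show "Poly_Mapping.lookup x b = Poly_Mapping.lookup y b" for b
    by (cases b) (use assms in auto)
qed

lemma W_center_trivial:
  assumes "\<And>y. W_bracket y x = 0"
  shows "x = 0"
proof (rule W_eqI)
  have 1: "of_int (2 * m - k) * Poly_Mapping.lookup x (L (k - m)) = 0"
    "of_int (2 * m - k) * Poly_Mapping.lookup x (I (k - m)) = 0" for m k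
    using lookup_W_bracket_L[of m x k] by (simp_all add: assms)
  fix k
  show "Poly_Mapping.lookup x (L k) = Poly_Mapping.lookup 0 (L k)"
    \<comment> \<open>Bracketing with \<open>L (k + 1)\<close> moves degree \<open>k\<close> to
      degree \<open>2 * k + 1\<close> with factor \<open>(k + 1) - k = 1\<close>, so every
      coordinate can be read off.\<close>
    using 1(1)[of "k + 1" "2 * k + 1"] by simp
  show "Poly_Mapping.lookup x (I k) = Poly_Mapping.lookup 0 (I k)"
    using 1(2)[of "k + 1" "2 * k + 1"] by simp
qed

text \<open>This is the degree derivation for the grading that puts each \<open>L n\<close> in
  degree 0 and each \<open>I n\<close> in degree 1.\<close>

definition I_projection :: "(W_index \<Rightarrow>\<^sub>0 complex) \<Rightarrow> (W_index \<Rightarrow>\<^sub>0 complex)"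
  where "I_projection = linear_extension (\<lambda>b. case b of L n \<Rightarrow> 0 | I n \<Rightarrow> basis_vector (I n))"

lemma pm_linear_I_projection: "pm_linear I_projection"
  by (simp add: I_projection_def pm_linear_extension)

lemmas I_projection_linear = pm_linear_simps[OF pm_linear_I_projection]

lemma I_projection_basis [simp]:
  "I_projection (basis_vector (L n)) = 0"
  "I_projection (basis_vector (I n)) = basis_vector (I n)"
  by (simp_all add: I_projection_def)

lemma lookup_I_projection:
  "Poly_Mapping.lookup (I_projection x) (L n) = 0"
  "Poly_Mapping.lookup (I_projection x) (I n) = Poly_Mapping.lookup x (I n)"
proof (induction x rule: basis_induct)
  case (add c b x)
  { case 1
    show ?case using add
      by (cases b) (auto simp: I_projection_linear lookup_add lookup_single when_def
          simp del: pm_scale_single) }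
  { case 2
    show ?case using add
      by (cases b) (auto simp: I_projection_linear lookup_add lookup_single when_def
          simp del: pm_scale_single) }
qed (simp_all add: I_projection_linear)

section \<open>Classification of the derivations of \<open>W\<close>\<close>

lemma additive_off_diagonal:
  fixes \<alpha> :: "int \<Rightarrow> complex"
  assumes "\<And>m n. m \<noteq> n \<Longrightarrow> \<alpha> (m + n) = \<alpha> m + \<alpha> n"
  shows "\<alpha> n = of_int n * \<alpha> 1"
proof -
  have 0: "\<alpha> 0 = 0" using assms[of 0 1] by simp
  have neg: "\<alpha> (- n) = - \<alpha> n" for n
    using assms[of n "- n"] 0 by (cases "n = 0") (auto simp: eq_neg_iff_add_eq_0 add.commute)
  \<comment> \<open>The diagonal sum 1 + 1 is excluded, so the value at 2 comes from 1 = 2 + (-1).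
    It supplies the one step of the induction below that would need the diagonal.\<close>
  have 2: "\<alpha> 2 = 2 * \<alpha> 1" using assms[of 2 "- 1"] neg[of 1] by simp
  have nat: "\<alpha> (int k) = of_nat k * \<alpha> 1" for k
  proof (induction k)
    case (Suc k)
    then show ?case
      using assms[of "int k" 1] 2 by (cases "k = 1") (auto simp: algebra_simps)
  qed (simp add: 0)
  show ?thesis
    by (cases n rule: int_cases2) (simp_all add: nat neg)
qed

text \<open>Since \<open>[w, L_0]\<close> has components \<open>n w_n\<close>, all of \<open>D L_0\<close> outside degree \<open>0\<close> is inner.\<close>

lemma W_derivation_reduce_degree:
  obtains w where
    "\<And>n. n \<noteq> 0 \<Longrightarrow> Poly_Mapping.lookup (W_bracket w (basis_vector (L 0))) (L n) = Poly_Mapping.lookup u (L n)"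
    "\<And>n. n \<noteq> 0 \<Longrightarrow> Poly_Mapping.lookup (W_bracket w (basis_vector (L 0))) (I n) = Poly_Mapping.lookup u (I n)"
proof -
  \<comment> \<open>Each coordinate is divided by its degree. In degree 0 the convention
    \<open>inverse 0 = 0\<close> makes the coordinate vanish.\<close>
  define w where "w = linear_extension
    (\<lambda>b. pm_scale (inverse (of_int (case b of L n \<Rightarrow> n | I n \<Rightarrow> n))) (basis_vector b)) u"
  have w: "Poly_Mapping.lookup w b = inverse (of_int (case b of L n \<Rightarrow> n | I n \<Rightarrow> n)) * Poly_Mapping.lookup u b"
    for b
    unfolding w_def
    by (induction u rule: basis_induct)
      (auto simp: pm_linear_simps[OF pm_linear_extension] lookup_add lookup_single when_def
        algebra_simps simp del: pm_scale_single)
  show ?thesis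
    by (rule that[of w])
      (simp_all add: W.bracket_anti[of w] lookup_W_bracket_L w)
qed

text \<open>Comparing coordinates in the Leibniz rule on basis vectors first forces \<open>D\<close>
  to preserve degree, then leaves three free parameters: multiples of the inner derivations of
  \<open>L 0\<close> and \<open>I 0\<close>, and a multiple of \<open>I_projection\<close>.\<close>

lemma W_derivation_degree_zero:
  assumes D: "D \<in> derivations pm_scale W_bracket"
    and D0: "\<And>n. n \<noteq> 0 \<Longrightarrow> Poly_Mapping.lookup (D (basis_vector (L 0))) (L n) = 0"
      "\<And>n. n \<noteq> 0 \<Longrightarrow> Poly_Mapping.lookup (D (basis_vector (L 0))) (I n) = 0"
  shows "\<exists>w c. D = (\<lambda>x. W_bracket w x + pm_scale c (I_projection x))"
proof -
  have lin: "pm_linear D" and Dbr: "D (W_bracket x y) = W_bracket (D x) y + W_bracket x (D y)" for x y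
    using D by (auto simp: derivations_def)
  define a where "a m n = Poly_Mapping.lookup (D (basis_vector (L m))) (L n)" for m n
  define b where "b m n = Poly_Mapping.lookup (D (basis_vector (L m))) (I n)" for m n
  define g where "g m n = Poly_Mapping.lookup (D (basis_vector (I m))) (L n)" for m n
  define e where "e m n = Poly_Mapping.lookup (D (basis_vector (I m))) (I n)" for m n
  \<comment> \<open>Antisymmetry puts every value of \<open>D\<close> into the second argument,
    where the coordinate formulas for brackets apply.\<close>
  have LL: "pm_scale (of_int (m - n)) (D (basis_vector (L (m + n)))) =
      W_bracket (basis_vector (L m)) (D (basis_vector (L n))) -
      W_bracket (basis_vector (L n)) (D (basis_vector (L m)))" for m n
    using Dbr[of "basis_vector (L m)" "basis_vector (L n)"]
    by (simp add: W_relations pm_linear_simps[OF lin] W.bracket_anti[of "D (basis_vector (L m))"]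
      del: pm_scale_single)
  have LI: "pm_scale (of_int (m - n)) (D (basis_vector (I (m + n)))) =
      W_bracket (basis_vector (L m)) (D (basis_vector (I n))) -
      W_bracket (basis_vector (I n)) (D (basis_vector (L m)))" for m n
    using Dbr[of "basis_vector (L m)" "basis_vector (I n)"]
    by (simp add: W_relations pm_linear_simps[OF lin] W.bracket_anti[of "D (basis_vector (L m))"]
      del: pm_scale_single)
  have II: "0 = W_bracket (basis_vector (I m)) (D (basis_vector (I n))) -
      W_bracket (basis_vector (I n)) (D (basis_vector (I m)))" for m n
    using Dbr[of "basis_vector (I m)" "basis_vector (I n)"]
    by (simp add: W_relations pm_linear_simps[OF lin] W.bracket_anti[of "D (basis_vector (I m))"])
  note lk = lookup_minus lookup_W_bracket_L lookup_W_bracket_I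
  have LLa: "of_int (m - n) * a (m + n) k = of_int (2 * m - k) * a n (k - m) - of_int (2 * n - k) * a m (k - n)"
    and LLb: "of_int (m - n) * b (m + n) k = of_int (2 * m - k) * b n (k - m) - of_int (2 * n - k) * b m (k - n)"
    for m n k
    using arg_cong[OF LL[of m n], of "\<lambda>x. Poly_Mapping.lookup x (L k)"]
      arg_cong[OF LL[of m n], of "\<lambda>x. Poly_Mapping.lookup x (I k)"]
    by (simp_all only: lookup_pm_scale lk a_def b_def)
  have LIg: "of_int (m - n) * g (m + n) k = of_int (2 * m - k) * g n (k - m)"
    and LIe: "of_int (m - n) * e (m + n) k = of_int (2 * m - k) * e n (k - m) - of_int (2 * n - k) * a m (k - n)"
    for m n k
    using arg_cong[OF LI[of m n], of "\<lambda>x. Poly_Mapping.lookup x (L k)"]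
      arg_cong[OF LI[of m n], of "\<lambda>x. Poly_Mapping.lookup x (I k)"]
    by (simp_all only: lookup_pm_scale lk a_def g_def e_def diff_zero)
  have IIg: "0 = of_int (2 * m - k) * g n (k - m) - of_int (2 * n - k) * g m (k - n)" for m n k
    using arg_cong[OF II[of m n], of "\<lambda>x. Poly_Mapping.lookup x (I k)"]
    by (simp only: lk g_def lookup_zero)
  have ab0: "a 0 k = 0" "b 0 k = 0" for k
  proof -
    have "a 0 0 = 0" "b 0 0 = 0"
      \<comment> \<open>The Leibniz rule for the pair \<open>L 0\<close>, \<open>L 1\<close>, read
        in degree 1, removes the remaining degree 0 coordinates of
        \<open>D (basis_vector (L 0))\<close>.\<close>
      using LLa[of 0 1 1] LLb[of 0 1 1] by simp_all
    then show "a 0 k = 0" "b 0 k = 0"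
      using D0[of k] by (cases "k = 0"; simp add: a_def b_def)+
  qed
  \<comment> \<open>Since \<open>D\<close> kills \<open>L 0\<close>, it commutes with the bracket by
    \<open>L 0\<close>, which acts on degree \<open>k\<close> as \<open>- k\<close>. Hence
    \<open>D\<close> preserves these eigenspaces.\<close>
  have off: "a n k = 0" "b n k = 0" "g n k = 0" "e n k = 0" if "k \<noteq> n" for n k
    using LLa[of 0 n k] LLb[of 0 n k] LIg[of 0 n k] LIe[of 0 n k] that by (simp_all add: ab0)
  define \<alpha> \<beta> where "\<alpha> = a 1 1" and "\<beta> = b 1 1"
  have a: "a n n = of_int n * \<alpha>" for n
    unfolding \<alpha>_def
  proof (rule additive_off_diagonal[of "\<lambda>n. a n n"])
    show "a (m + n) (m + n) = a m m + a n n" if "m \<noteq> n" for m n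
    proof -
      \<comment> \<open>In degree \<open>m + n\<close> both structure constants equal
        \<open>m - n\<close> up to sign. This factor cancels only for distinct \<open>m\<close> and
        \<open>n\<close>, hence additivity off the diagonal.\<close>
      have "of_int (m - n) * a (m + n) (m + n) = of_int (m - n) * (a m m + a n n)"
        using LLa[of m n "m + n"] by (simp add: algebra_simps)
      with that show ?thesis by simp
    qed
  qed
  have b: "b n n = of_int n * \<beta>" for n
    unfolding \<beta>_def
  proof (rule additive_off_diagonal[of "\<lambda>n. b n n"])
    show "b (m + n) (m + n) = b m m + b n n" if "m \<noteq> n" for m n
    proof -
      have "of_int (m - n) * b (m + n) (m + n) = of_int (m - n) * (b m m + b n n)"
        using LLb[of m n "m + n"] by (simp add: algebra_simps)
      with that show ?thesis by simp
    qed
  qed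
  have g_const: "g n n = g 0 0" for n
    using LIg[of n 0 n] by (cases "n = 0") auto
  \<comment> \<open>The relation \<open>[I_1, I_0] = 0\<close>, read in degree 1, gives
    \<open>g 0 0 + g 1 1 = 0\<close>, and the two summands are equal by
    \<open>g_const\<close>.\<close>
  have g: "g n n = 0" for n
    using IIg[of 1 1 0] g_const[of 1] g_const[of n] by simp
  have e: "e n n = of_int n * \<alpha> + e 0 0" for n
  proof (cases "n = 0")
    case False
    have "of_int n * e n n = of_int n * (of_int n * \<alpha> + e 0 0)"
      using LIe[of n 0 n] by (simp add: a algebra_simps)
    with False show ?thesis by simp
  qed simp
  \<comment> \<open>The signs compensate for \<open>[L_0, L_n] = - n L_n\<close>,
    \<open>[L_0, I_n] = - n I_n\<close> and \<open>[I_0, L_n] = - n I_n\<close>. The constant part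
    \<open>e 0 0\<close> on the \<open>I n\<close> is left to \<open>I_projection\<close>.\<close>
  define w where "w = - pm_scale \<alpha> (basis_vector (L 0)) - pm_scale \<beta> (basis_vector (I 0))"
  define R where "R x = W_bracket w x + pm_scale (e 0 0) (I_projection x)" for x
  have R: "pm_linear R"
    by (simp add: R_def pm_linear_iff I_projection_linear W.bracket_add_right
        W.bracket_scale_right pm.scale_right_distrib mult.commute)
  have w: "W_bracket w x = - pm_scale \<alpha> (W_bracket (basis_vector (L 0)) x) -
      pm_scale \<beta> (W_bracket (basis_vector (I 0)) x)" for x
    unfolding w_def diff_conv_add_uminus
    by (simp only: W.bracket_add_left W.bracket_minus_left W.bracket_scale_left)
  have lookup_R:
    "Poly_Mapping.lookup (R x) (L k) = of_int k * \<alpha> * Poly_Mapping.lookup x (L k)"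
    "Poly_Mapping.lookup (R x) (I k) = of_int k * \<beta> * Poly_Mapping.lookup x (L k) +
      (of_int k * \<alpha> + e 0 0) * Poly_Mapping.lookup x (I k)" for x k
    by (simp_all add: R_def w lookup_add lk lookup_I_projection algebra_simps)
  have "D x = R x" for x
  proof (rule pm_linear_eqI[OF lin R])
    fix i
    show "D (basis_vector i) = R (basis_vector i)"
    proof (cases i)
      case (L n)
      have "a n k = (if k = n then of_int n * \<alpha> else 0)"
        "b n k = (if k = n then of_int n * \<beta> else 0)" for k
        using off[of k n] a[of n] b[of n] by simp_all
      then show ?thesis
        unfolding L by (intro W_eqI) (simp_all add: lookup_R lookup_single when_def a_def b_def)
    next
      case (I n)
      have "g n k = 0" "e n k = (if k = n then of_int n * \<alpha> + e 0 0 else 0)" for k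
        using off[of k n] g[of n] e[of n] by (cases "k = n"; simp)+
      then show ?thesis
        unfolding I
        by (intro W_eqI) (simp_all add: lookup_R lookup_single when_def g_def e_def)
    qed
  qed
  then have "D = (\<lambda>x. W_bracket w x + pm_scale (e 0 0) (I_projection x))"
    by (simp add: fun_eq_iff R_def)
  then show ?thesis by blast
qed

text \<open>An inner derivation is subtracted so that the image of \<open>L 0\<close> lies in degree
  0; the previous classification then applies to the difference.\<close>

lemma W_derivationE:
  assumes "D \<in> derivations pm_scale W_bracket"
  obtains w c where "D = (\<lambda>x. W_bracket w x + pm_scale c (I_projection x))"
proof -
  obtain v where v:
    "\<And>n. n \<noteq> 0 \<Longrightarrow> Poly_Mapping.lookup (W_bracket v (basis_vector (L 0))) (L n) =
      Poly_Mapping.lookup (D (basis_vector (L 0))) (L n)"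
    "\<And>n. n \<noteq> 0 \<Longrightarrow> Poly_Mapping.lookup (W_bracket v (basis_vector (L 0))) (I n) =
      Poly_Mapping.lookup (D (basis_vector (L 0))) (I n)"
    using W_derivation_reduce_degree[of "D (basis_vector (L 0))"] by blast
  have "W_bracket (- v) \<in> derivations pm_scale W_bracket"
    using W.inner_derivations_subset by (auto simp: inner_derivations_def)
  with assms have "D + W_bracket (- v) \<in> derivations pm_scale W_bracket"
    by (rule W.derivations_add)
  moreover have "Poly_Mapping.lookup ((D + W_bracket (- v)) (basis_vector (L 0))) (L n) = 0"
    "Poly_Mapping.lookup ((D + W_bracket (- v)) (basis_vector (L 0))) (I n) = 0" if "n \<noteq> 0" for n
    using v[OF that] by (simp_all add: W.bracket_minus_left lookup_minus)
  ultimately obtain w c where "D + W_bracket (- v) = (\<lambda>x. W_bracket w x + pm_scale c (I_projection x))"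
    using W_derivation_degree_zero by blast
  then have "D x - W_bracket v x = W_bracket w x + pm_scale c (I_projection x)" for x
    by (simp add: fun_eq_iff W.bracket_minus_left)
  then have "D = (\<lambda>x. W_bracket (v + w) x + pm_scale c (I_projection x))"
    by (simp add: fun_eq_iff W.bracket_add_left diff_eq_eq ac_simps)
  then show ?thesis by (rule that)
qed

section \<open>The central extension\<close>

definition W_proj :: "(Wt_index \<Rightarrow>\<^sub>0 complex) \<Rightarrow> (W_index \<Rightarrow>\<^sub>0 complex)"
  where "W_proj = linear_extension
    (\<lambda>b. case b of Lt n \<Rightarrow> basis_vector (L n) | It n \<Rightarrow> basis_vector (I n) | _ \<Rightarrow> 0)"

definition W_sect :: "(W_index \<Rightarrow>\<^sub>0 complex) \<Rightarrow> (Wt_index \<Rightarrow>\<^sub>0 complex)"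
  where "W_sect = linear_extension
    (\<lambda>b. case b of L n \<Rightarrow> basis_vector (Lt n) | I n \<Rightarrow> basis_vector (It n))"

text \<open>This lifts \<open>I_projection\<close>. The vector \<open>C2\<close> must be kept
  because it occurs in brackets \<open>[L_m, I_n]\<close> with \<open>m + n = 0\<close>; the map is
  the degree derivation with \<open>Lt n\<close>, \<open>C1\<close> in degree 0 and
  \<open>It n\<close>, \<open>C2\<close> in degree 1.\<close>

definition IC_projection :: "(Wt_index \<Rightarrow>\<^sub>0 complex) \<Rightarrow> (Wt_index \<Rightarrow>\<^sub>0 complex)"
  where "IC_projection = linear_extension
    (\<lambda>b. case b of It n \<Rightarrow> basis_vector (It n) | C2 \<Rightarrow> basis_vector C2 | _ \<Rightarrow> 0)"

lemma pm_linear_W_proj: "pm_linear W_proj"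
  by (simp add: W_proj_def pm_linear_extension)

lemma pm_linear_W_sect: "pm_linear W_sect"
  by (simp add: W_sect_def pm_linear_extension)

lemma pm_linear_IC_projection: "pm_linear IC_projection"
  by (simp add: IC_projection_def pm_linear_extension)

lemmas W_proj_linear = pm_linear_simps[OF pm_linear_W_proj]
lemmas W_sect_linear = pm_linear_simps[OF pm_linear_W_sect]
lemmas IC_projection_linear = pm_linear_simps[OF pm_linear_IC_projection]

lemma W_proj_basis [simp]:
  "W_proj (basis_vector (Lt n)) = basis_vector (L n)"
  "W_proj (basis_vector (It n)) = basis_vector (I n)"
  "W_proj (basis_vector C1) = 0" "W_proj (basis_vector C2) = 0"
  by (simp_all add: W_proj_def)

lemma W_sect_basis [simp]:
  "W_sect (basis_vector (L n)) = basis_vector (Lt n)"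
  "W_sect (basis_vector (I n)) = basis_vector (It n)"
  by (simp_all add: W_sect_def)

lemma IC_projection_basis [simp]:
  "IC_projection (basis_vector (Lt n)) = 0"
  "IC_projection (basis_vector (It n)) = basis_vector (It n)"
  "IC_projection (basis_vector C1) = 0" "IC_projection (basis_vector C2) = basis_vector C2"
  by (simp_all add: IC_projection_def)

lemma W_proj_sect [simp]: "W_proj (W_sect x) = x"
proof (rule pm_linear_eqI[where f = "\<lambda>x. W_proj (W_sect x)" and g = "\<lambda>x. x"])
  show "W_proj (W_sect (basis_vector b)) = basis_vector b" for b by (cases b) simp_all
qed (simp_all add: pm_linear_iff W_proj_linear W_sect_linear)

lemma W_proj_bracket: "W_proj (Wt_bracket x y) = W_bracket (W_proj x) (W_proj y)"
proof (rule bilinear_map_eqI[where f = "\<lambda>x y. W_proj (Wt_bracket x y)"])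
  show "W_proj (Wt_bracket (basis_vector i) (basis_vector j)) =
      W_bracket (W_proj (basis_vector i)) (W_proj (basis_vector j))" for i j
    by (cases i; cases j)
      (simp_all add: Wt_bracket_def W_bracket_def bilinear_extension_linear[THEN pm_linear_zero]
        W_proj_linear del: pm_scale_single)
qed (simp_all add: pm_linear_iff W_proj_linear W.bracket_add_left W.bracket_add_right
    W.bracket_scale_left W.bracket_scale_right Wt.bracket_add_left Wt.bracket_add_right
    Wt.bracket_scale_left Wt.bracket_scale_right)

lemma lookup_W_proj:
  "Poly_Mapping.lookup (W_proj x) (L n) = Poly_Mapping.lookup x (Lt n)"
  "Poly_Mapping.lookup (W_proj x) (I n) = Poly_Mapping.lookup x (It n)"
proof (induction x rule: basis_induct)
  case (add c b x)
  { case 1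
    show ?case using add
      by (cases b) (auto simp: W_proj_linear lookup_add lookup_single when_def simp del: pm_scale_single) }
  { case 2
    show ?case using add
      by (cases b) (auto simp: W_proj_linear lookup_add lookup_single when_def simp del: pm_scale_single) }
qed (simp_all add: W_proj_linear)

lemma W_proj_kernel_central:
  assumes "W_proj z = 0"
  shows "Wt_bracket z x = 0"
proof -
  have "z = pm_scale (Poly_Mapping.lookup z C1) (basis_vector C1) +
      pm_scale (Poly_Mapping.lookup z C2) (basis_vector C2)"
  proof (rule poly_mapping_eqI)
    fix b
    show "Poly_Mapping.lookup z b = Poly_Mapping.lookup
        (pm_scale (Poly_Mapping.lookup z C1) (basis_vector C1) +
         pm_scale (Poly_Mapping.lookup z C2) (basis_vector C2)) b"
      using lookup_W_proj[of z] assms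
      by (cases b) (auto simp: lookup_add lookup_single when_def)
  qed
  then have "Wt_bracket z x = Wt_bracket (pm_scale (Poly_Mapping.lookup z C1) (basis_vector C1) +
      pm_scale (Poly_Mapping.lookup z C2) (basis_vector C2)) x"
    by (rule arg_cong)
  then show ?thesis
    by (simp only: Wt.bracket_add_left Wt.bracket_scale_left Wt_central) simp
qed

text \<open>Every basis vector is a linear combination of brackets, so a linear map killing all
  brackets vanishes.\<close>

lemma Wt_perfect:
  assumes D: "pm_linear D" and br: "\<And>x y. D (Wt_bracket x y) = 0"
  shows "D x = 0"
proof -
  note lin = pm_linear_simps[OF D]
  \<comment> \<open>For nonzero \<open>n\<close> use \<open>[L_0, L_n] = - n L_n\<close>, and for
    \<open>n = 0\<close> use \<open>[L_1, L_{-1}] = 2 L_0\<close>. Neither bracket has a central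
    term, since \<open>m ^ 3 - m\<close> vanishes at \<open>m = 1\<close>.\<close>
  have Lt: "D (basis_vector (Lt n)) = 0" for n
    using br[of "basis_vector (Lt 0)" "basis_vector (Lt n)"]
      br[of "basis_vector (Lt 1)" "basis_vector (Lt (- 1))"]
    by (cases "n = 0") (simp_all add: Wt_relations lin del: pm_scale_single split: if_splits)
  have It: "D (basis_vector (It n)) = 0" for n
    using br[of "basis_vector (Lt 0)" "basis_vector (It n)"]
      br[of "basis_vector (Lt 1)" "basis_vector (It (- 1))"]
    by (cases "n = 0") (simp_all add: Wt_relations lin del: pm_scale_single split: if_splits)
  \<comment> \<open>At \<open>m = 2\<close> the cocycle has the nonzero value 6/12, so the central
    vectors are recovered from \<open>[L_2, L_{-2}]\<close> and
    \<open>[L_2, I_{-2}]\<close>.\<close>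
  have C: "D (basis_vector C1) = 0" "D (basis_vector C2) = 0"
    using br[of "basis_vector (Lt 2)" "basis_vector (Lt (- 2))"]
      br[of "basis_vector (Lt 2)" "basis_vector (It (- 2))"]
    by (simp_all add: Wt_relations lin Lt It del: pm_scale_single)
  show ?thesis
  proof (rule additive_eq_zero[where g = D])
    show "D (basis_vector b) = 0" for b by (cases b) (simp_all add: Lt It C)
  qed (simp_all add: lin)
qed

lemma IC_projection_derivation: "IC_projection \<in> derivations pm_scale Wt_bracket"
  unfolding Wt_bracket_def
proof (rule derivation_on_basisI)
  show "IC_projection (Wt_bracket_basis i j) =
      bilinear_extension Wt_bracket_basis (IC_projection (basis_vector i)) (basis_vector j) +
      bilinear_extension Wt_bracket_basis (basis_vector i) (IC_projection (basis_vector j))" for i j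
    by (cases i; cases j)
      (simp_all add: IC_projection_linear bilinear_extension_linear[THEN pm_linear_zero]
        del: pm_scale_single)
qed (simp add: IC_projection_def pm_linear_extension)

section \<open>Descending and lifting derivations\<close>

text \<open>Composing with a section gives a formula that is defined, and linear in
  \<open>D\<close>, for arbitrary maps, not only for those preserving the kernel of
  \<open>W_proj\<close>.\<close>

definition descend :: "((Wt_index \<Rightarrow>\<^sub>0 complex) \<Rightarrow> (Wt_index \<Rightarrow>\<^sub>0 complex)) \<Rightarrow>
    (W_index \<Rightarrow>\<^sub>0 complex) \<Rightarrow> (W_index \<Rightarrow>\<^sub>0 complex)"
  where "descend D x = W_proj (D (W_sect x))"

text \<open>The derivation preserves the kernel of \<open>W_proj\<close>: for central
  \<open>z\<close>, the Leibniz rule shows that \<open>D z\<close> commutes with everything, so its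
  projection is central in \<open>W\<close> and hence zero. The descended map thus does not depend
  on the chosen lift.\<close>

lemma descend_proj:
  assumes D: "D \<in> derivations pm_scale Wt_bracket"
  shows "W_proj (D x) = descend D (W_proj x)"
proof -
  have lin: "pm_linear D" and Dbr: "D (Wt_bracket x y) = Wt_bracket (D x) y + Wt_bracket x (D y)" for x y
    using D by (auto simp: derivations_def)
  define z where "z = x - W_sect (W_proj x)"
  have z: "W_proj z = 0" by (simp add: z_def W_proj_linear)
  have "W_proj (D z) = 0"
  proof (rule W_center_trivial)
    fix y
    have "Wt_bracket (D z) (W_sect y) = 0"
      using Dbr[of z "W_sect y"] by (simp add: W_proj_kernel_central[OF z] pm_linear_zero[OF lin])
    then have "W_bracket (W_proj (D z)) y = 0"
      using W_proj_bracket[of "D z" "W_sect y"] by (simp add: W_proj_linear)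
    then show "W_bracket y (W_proj (D z)) = 0"
      by (simp add: W.bracket_anti[of y])
  qed
  then show ?thesis
    by (simp add: z_def descend_def W_proj_linear pm_linear_diff[OF lin])
qed

lemma descend_derivation:
  assumes D: "D \<in> derivations pm_scale Wt_bracket"
  shows "descend D \<in> derivations pm_scale W_bracket"
proof -
  have lin: "pm_linear D" and Dbr: "D (Wt_bracket x y) = Wt_bracket (D x) y + Wt_bracket x (D y)" for x y
    using D by (auto simp: derivations_def)
  have "descend D (W_bracket x y) = W_bracket (descend D x) y + W_bracket x (descend D y)" for x y
  proof -
    \<comment> \<open>The section does not preserve brackets, but the bracket of the lifts is still
      a lift of \<open>W_bracket x y\<close>, which suffices by \<open>descend_proj\<close>.\<close>
    have "descend D (W_bracket x y) = W_proj (D (Wt_bracket (W_sect x) (W_sect y)))"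
      by (simp add: descend_proj[OF D] W_proj_bracket)
    then show ?thesis
      by (simp add: Dbr W_proj_linear W_proj_bracket descend_def)
  qed
  then show ?thesis
    by (simp add: derivations_def pm_linear_iff descend_def W_proj_linear W_sect_linear
        pm_linear_simps[OF lin])
qed

lemma descend_bracket: "descend (Wt_bracket x) = W_bracket (W_proj x)"
  by (simp add: fun_eq_iff descend_def W_proj_bracket)

lemma descend_IC_projection: "descend IC_projection = I_projection"
proof
  fix x
  show "descend IC_projection x = I_projection x"
  proof (rule pm_linear_eqI[where f = "descend IC_projection"])
    show "descend IC_projection (basis_vector b) = I_projection (basis_vector b)" for b
      by (cases b) (simp_all add: descend_def IC_projection_linear W_proj_linear)
  qed (simp_all add: pm_linear_iff descend_def IC_projection_linear W_proj_linear
      W_sect_linear I_projection_linear)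
qed

lemma descend_inner: "descend ` inner_derivations Wt_bracket = inner_derivations W_bracket"
proof -
  have "range W_proj = UNIV" by (metis W_proj_sect surjI)
  then have "range W_bracket = W_bracket ` range W_proj" by simp
  then show ?thesis
    by (simp only: inner_derivations_def image_image descend_bracket)
qed

text \<open>By the classification only two kinds of derivation need lifting: the inner one of
  \<open>w\<close> lifts to that of \<open>W_sect w\<close>, and \<open>I_projection\<close> lifts
  to \<open>IC_projection\<close>.\<close>

lemma descend_surj: "descend ` derivations pm_scale Wt_bracket = derivations pm_scale W_bracket"
proof
  show "derivations pm_scale W_bracket \<subseteq> descend ` derivations pm_scale Wt_bracket"
  proof
    fix E assume "E \<in> derivations pm_scale W_bracket"
    then obtain w c where E: "E = (\<lambda>x. W_bracket w x + pm_scale c (I_projection x))"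
      by (rule W_derivationE)
    define D where "D = Wt_bracket (W_sect w) + (\<lambda>x. pm_scale c (IC_projection x))"
    have "Wt_bracket (W_sect w) \<in> derivations pm_scale Wt_bracket"
      using Wt.inner_derivations_subset by (auto simp: inner_derivations_def)
    then have "D \<in> derivations pm_scale Wt_bracket"
      unfolding D_def
      by (intro Wt.derivations_add Wt.derivations_scale IC_projection_derivation)
    moreover have "E = descend D"
      by (simp add: fun_eq_iff E D_def descend_def W_proj_linear W_proj_bracket
          descend_IC_projection[symmetric])
    ultimately show "E \<in> descend ` derivations pm_scale Wt_bracket" by blast
  qed
qed (auto intro: descend_derivation)

lemma descend_inner_imp_inner:
  assumes D: "D \<in> derivations pm_scale Wt_bracket" and "descend D \<in> inner_derivations W_bracket"
  shows "D \<in> inner_derivations Wt_bracket"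
proof -
  obtain w where w: "descend D = W_bracket w"
    using assms(2) by (auto simp: inner_derivations_def)
  define E where "E = D + Wt_bracket (- W_sect w)"
  have "Wt_bracket (- W_sect w) \<in> derivations pm_scale Wt_bracket"
    using Wt.inner_derivations_subset by (auto simp: inner_derivations_def)
  with D have E: "E \<in> derivations pm_scale Wt_bracket"
    unfolding E_def by (rule Wt.derivations_add)
  have "W_proj (E x) = 0" for x
    using descend_proj[OF D, of x]
    by (simp add: E_def w W_proj_linear W_proj_bracket W.bracket_minus_left)
  then have central: "Wt_bracket (E x) y = 0" "Wt_bracket y (E x) = 0" for x y
    by (simp_all add: W_proj_kernel_central Wt.bracket_anti[of y "E x"])
  \<comment> \<open>With central values, both terms of the Leibniz rule for \<open>E\<close> vanish,
    so \<open>E\<close> kills all brackets.\<close>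
  have "E x = 0" for x
    by (rule Wt_perfect) (use E in \<open>auto simp: derivations_def central\<close>)
  then have "D = Wt_bracket (W_sect w)"
    by (simp add: E_def fun_eq_iff Wt.bracket_minus_left)
  then show ?thesis by (simp add: inner_derivations_def)
qed

theorem corollary3p8:
  shows "H1_isomorphic pm_scale Wt_bracket pm_scale W_bracket"
proof (rule H1_isomorphicI[where F = descend])
  show "descend (D + E) = descend D + descend E" for D E
    by (simp add: fun_eq_iff descend_def W_proj_linear)
  show "descend (\<lambda>x. pm_scale c (D x)) = (\<lambda>x. pm_scale c (descend D x))" for c D
    by (simp add: fun_eq_iff descend_def W_proj_linear)
qed (rule W_lie_algebra Wt_lie_algebra descend_inner descend_surj descend_inner_imp_inner;
    assumption)+

end
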